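(* Let $F$ be a field of characteristic different from two. Nilpotent Lie algebras over $F$ of dimension one or two are abelian. In dimension three there are, up to isomorphism, exactly two nilpotent Lie algebras over $F$, and they are non-isomorphic: $L_{3,1}$, which is abelian, and the Heisenberg algebra $L_{3,2}$ with basis $e_1,e_2,e_3$ and non-zero product $[e_1,e_2]=e_3$. All of these algebras (of dimensions one, two and three) are CB-algebras.
   Context: A Lie algebra $L$ is a CB-algebra if, whenever $x,y\in L$ satisfy $[x,y]=0$, then $[[x,z],y]=0$ for all $z\in L$. Only non-zero products of basis elements are listed, with $[e_j,e_i]=-[e_i,e_j]$ understood. *)

theory Defs
  imports "HOL-Analysis.Analysis"
begin

locale lie_algebra = vector_space scale
  for scale :: "'f::field \<Rightarrow> 'v::ab_group_add \<Rightarrow> 'v" +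
  fixes bracket :: "'v \<Rightarrow> 'v \<Rightarrow> 'v"
  assumes bracket_add_left: "bracket (x + y) z = bracket x z + bracket y z"
    and bracket_add_right: "bracket x (y + z) = bracket x y + bracket x z"
    and bracket_scale_left: "bracket (scale a x) y = scale a (bracket x y)"
    and bracket_scale_right: "bracket x (scale a y) = scale a (bracket x y)"
    and bracket_self: "bracket x x = 0"
    and jacobi: "bracket x (bracket y z) + bracket y (bracket z x) + bracket z (bracket x y) = 0"
begin

primrec lower_central :: "nat \<Rightarrow> 'v set" where
  "lower_central 0 = UNIV"
| "lower_central (Suc k) = span {bracket x y | x y. y \<in> lower_central k}"

definition nilpotent :: bool where
  "nilpotent \<longleftrightarrow> (\<exists>k. lower_central k = {0})"

definition abelian :: bool where
  "abelian \<longleftrightarrow> (\<forall>x y. bracket x y = 0)"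

definition CB_algebra :: bool where
  "CB_algebra \<longleftrightarrow> (\<forall>x y. bracket x y = 0 \<longrightarrow> (\<forall>z. bracket (bracket x z) y = 0))"

end

definition lie_isomorphic ::
  "('f::field \<Rightarrow> 'v::ab_group_add \<Rightarrow> 'v) \<Rightarrow> ('v \<Rightarrow> 'v \<Rightarrow> 'v) \<Rightarrow>
   ('f \<Rightarrow> 'w::ab_group_add \<Rightarrow> 'w) \<Rightarrow> ('w \<Rightarrow> 'w \<Rightarrow> 'w) \<Rightarrow> bool" where
  "lie_isomorphic scale1 bracket1 scale2 bracket2 \<longleftrightarrow>
     (\<exists>f. Vector_Spaces.linear scale1 scale2 f \<and> bij f \<and>
          (\<forall>x y. f (bracket1 x y) = bracket2 (f x) (f y)))"

text \<open>The bilinear product on column vectors with \<open>[e\<^sub>i, e\<^sub>j] = t i j\<close>, where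
  \<open>e\<^sub>i = axis i 1\<close>.\<close>

definition table_bracket ::
  "('n::finite \<Rightarrow> 'n \<Rightarrow> 'f::field ^ 'n) \<Rightarrow> 'f ^ 'n \<Rightarrow> 'f ^ 'n \<Rightarrow> 'f ^ 'n" where
  "table_bracket t x y = (\<Sum>i\<in>UNIV. \<Sum>j\<in>UNIV. (x $ i * y $ j) *s t i j)"

definition L31 :: "'f::field ^ 3 \<Rightarrow> 'f ^ 3 \<Rightarrow> 'f ^ 3" where
  "L31 = table_bracket (\<lambda>i j. 0)"

definition L32 :: "'f::field ^ 3 \<Rightarrow> 'f ^ 3 \<Rightarrow> 'f ^ 3" where
  "L32 = table_bracket (\<lambda>i j.
     if i = 1 \<and> j = 2 then axis 3 1
     else if i = 2 \<and> j = 1 then - axis 3 1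
     else 0)"

end

theory Submission
  imports Defs
begin

text \<open>A non-zero nilpotent Lie algebra has a non-zero central element \<open>z\<close>. If \<open>[x, y] \<noteq> 0\<close>, then
  \<open>x, y, z\<close> are independent; this excludes dimensions one and two, and in dimension three
  \<open>w = [x, y] = a x + b y + c z\<close>. Now \<open>[x, w] = b w\<close> and \<open>[y, w] = - a w\<close>, and since nilpotency
  forbids non-zero eigenvalues of the adjoint maps, \<open>w = c z\<close> is central. So \<open>x, y, w\<close> is a
  Heisenberg basis, and every double bracket vanishes, which gives the CB property.\<close>

context lie_algebra
begin

lemma bracket_zero_left [simp]: "bracket 0 y = 0"
  using bracket_add_left[of 0 0 y] by simp

lemma bracket_zero_right [simp]: "bracket x 0 = 0"
  using bracket_add_right[of x 0 0] by simp

text \<open>Polarisation: expand [x + y, x + y] = 0.\<close>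

lemma bracket_minus_flip: "bracket y x = - bracket x y"
proof -
  have "bracket (x + y) (x + y) = bracket y x + bracket x y"
    by (simp only: bracket_add_left bracket_add_right) (simp add: bracket_self)
  then show ?thesis
    by (simp add: bracket_self eq_neg_iff_add_eq_0)
qed

section \<open>The lower central series: eigenvalues and centre\<close>

lemma zero_in_lower_central: "0 \<in> lower_central k"
  by (cases k) (simp_all add: span_zero)

text \<open>If c were non-zero, w would be a multiple of [x, w], so membership of w would pass from
  each term of the lower central series to the next, and the series could not reach zero.\<close>

lemma eigenvalue_zero_if_nilpotent:
  assumes "nilpotent" and eig: "bracket x w = scale c w" and "w \<noteq> 0"
  shows "c = 0"
proof (rule ccontr)
  assume c: "c \<noteq> 0"
  have "w \<in> lower_central k" for k
  proof (induction k)
    case (Suc k)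
    then have "bracket x w \<in> lower_central (Suc k)"
      by (auto intro: span_base)
    then have "scale (inverse c) (scale c w) \<in> lower_central (Suc k)"
      unfolding eig lower_central.simps by (rule span_scale)
    with c show ?case by simp
  qed simp
  with assms show False
    by (auto simp: nilpotent_def)
qed

text \<open>The last non-zero term of the lower central series is central, because its brackets with
  all elements lie in the next term. The vector \<open>u\<close> ensures that the series does not
  start at zero, so such a term exists.\<close>

lemma nilpotent_obtains_central:
  fixes u :: 'v
  assumes "nilpotent" and "u \<noteq> 0"
  obtains z where "z \<noteq> 0" and "\<And>x. bracket x z = 0"
proof -
  define k where "k = (LEAST k. lower_central k = {0})"
  have k: "lower_central k = {0}"
    using assms unfolding nilpotent_def k_def by (metis (mono_tags, lifting) LeastI_ex)
  have "k \<noteq> 0"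
    using k assms(2) by (metis UNIV_I lower_central.simps(1) singletonD)
  then obtain m where m: "k = Suc m"
    using not0_implies_Suc by blast
  have "lower_central m \<noteq> {0}"
    using not_less_Least[of m "\<lambda>k. lower_central k = {0}"] m by (simp add: k_def)
  then obtain z where z: "z \<in> lower_central m" "z \<noteq> 0"
    using zero_in_lower_central[of m] by blast
  have "bracket x z \<in> lower_central k" for x
    using z(1) by (auto simp: m intro: span_base)
  with k z(2) show ?thesis
    by (intro that) auto
qed

section \<open>Linear independence and dimension\<close>

lemma independent_bracket_central:
  assumes w: "bracket x y \<noteq> 0" and z: "z \<noteq> 0" "\<And>u. bracket u z = 0"
  shows "independent {x, y, z}" and "card {x, y, z} = 3"
proof -
  have "y \<noteq> 0"
    using w by auto
  \<comment> \<open>A multiple of y commutes with y.\<close>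
  have x: "x \<notin> span {y}"
    using w by (auto simp: span_singleton bracket_scale_left bracket_self)
  have "z \<notin> span {x, y}"
  proof
    assume "z \<in> span {x, y}"
    then obtain a b where ab: "z = scale a x + scale b y"
      by (auto simp: span_insert span_singleton algebra_simps)
    \<comment> \<open>Bracketing with y and x isolates the two coefficients; centrality of z makes
      both zero, so that z = 0.\<close>
    have "bracket y z = - scale a (bracket x y)" "bracket x z = scale b (bracket x y)"
      using bracket_minus_flip[of y x]
      by (simp_all add: ab bracket_add_right bracket_scale_right bracket_self)
    with w z ab show False by simp
  qed
  with x \<open>y \<noteq> 0\<close> have "independent {z, x, y}"
    by (simp add: independent_insert)
  moreover have "{z, x, y} = {x, y, z}" by auto
  ultimately show "independent {x, y, z}" by simp
  have "x \<noteq> y" "z \<noteq> x" "z \<noteq> y"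
    using x \<open>z \<notin> span {x, y}\<close> by (auto simp: span_base)
  then show "card {x, y, z} = 3" by auto
qed

text \<open>An infinite basis has \<open>card\<close> 0 and hence gives \<open>dim\<close> 0, so
  positivity encodes finite dimension.\<close>

lemma finite_basis_if_dim_pos:
  assumes "dim UNIV = n" and "0 < n"
  obtains B where "finite B" "independent B" "span B = UNIV" "card B = n"
  using basis_exists[of UNIV] assms
  by (metis card_gt_0_iff top.extremum_uniqueI)

lemma independent_spans_if_dim_le:
  assumes "dim UNIV = n" "0 < n" "independent C" "n \<le> card C"
  shows "span C = UNIV" and "card C = n"
proof -
  obtain B where B: "finite B" "independent B" "span B = UNIV" "card B = n"
    using finite_basis_if_dim_pos assms by blast
  then interpret finite_dimensional_vector_space scale B
    by unfold_locales auto
  have "card C \<le> n"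
    using independent_card_le_dim[of C UNIV] assms by simp
  then show "card C = n"
    using assms by simp
  then show "span C = UNIV"
    using card_ge_dim_independent[of C UNIV] assms by auto
qed

section \<open>Nilpotent algebras of dimension at most three\<close>

lemma abelian_if_dim_le_2:
  assumes "nilpotent" and "dim UNIV \<in> {1, 2}"
  shows "abelian"
  unfolding abelian_def
proof (intro allI, rule ccontr)
  fix x y assume w: "bracket x y \<noteq> 0"
  obtain z where z: "z \<noteq> 0" "\<And>u. bracket u z = 0"
    using nilpotent_obtains_central assms(1) w by metis
  show False
    \<comment> \<open>The dimension is at most 3, so the three independent vectors would force it to
      equal 3.\<close>
    using independent_spans_if_dim_le(2)[OF refl _ independent_bracket_central(1)[OF w z]]
      independent_bracket_central(2)[OF w z] assms(2) by auto
qed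

lemma bracket_central_if_dim_le_3:
  assumes nil: "nilpotent" and dim: "dim UNIV \<in> {1, 2, 3}"
  shows "bracket v (bracket x y) = 0"
proof (cases "bracket x y = 0")
  case False
  let ?w = "bracket x y"
  obtain z where z: "z \<noteq> 0" "\<And>u. bracket u z = 0"
    using nilpotent_obtains_central nil False by metis
  \<comment> \<open>All three dimensions are treated at once: three independent vectors are at least
    \<open>dim UNIV\<close> many, which suffices for spanning.\<close>
  have "span {x, y, z} = UNIV"
    using independent_spans_if_dim_le(1)[OF refl _ independent_bracket_central(1)[OF False z]]
      independent_bracket_central(2)[OF False z] dim by auto
  then have "?w \<in> span {x, y, z}" by simp
  then obtain a b c where w: "?w = scale a x + scale b y + scale c z"
    by (auto simp: span_insert span_singleton algebra_simps)
  have "bracket x ?w = scale b ?w"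
    by (subst w) (simp add: bracket_add_right bracket_scale_right bracket_self z)
  then have "b = 0"
    using eigenvalue_zero_if_nilpotent[OF nil _ False] by blast
  have "bracket y ?w = scale (- a) ?w"
    using bracket_minus_flip[of y x]
    by (subst w) (simp add: bracket_add_right bracket_scale_right bracket_self z)
  then have "- a = 0"
    using eigenvalue_zero_if_nilpotent[OF nil _ False] by blast
  with w \<open>b = 0\<close> have "?w = scale c z" by simp
  then show ?thesis
    by (simp add: bracket_scale_right z)
qed simp

section \<open>Vanishing double brackets and passage to coordinates\<close>

lemma CB_if_double_bracket_zero:
  assumes "\<And>x y z. bracket x (bracket y z) = 0"
  shows "CB_algebra"
  \<comment> \<open>Up to sign, [[x, z], y] is the double bracket [y, [x, z]].\<close>
  unfolding CB_algebra_def using assms bracket_minus_flip by (metis neg_equal_0_iff_equal)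

text \<open>Bracketing with a fixed element kills the generators of \<open>lower_central 1\<close>,
  hence by linearity their span. As index 0 is the whole algebra, the series vanishes at index
  2.\<close>

lemma nilpotent_if_double_bracket_zero:
  assumes "\<And>x y z. bracket x (bracket y z) = 0"
  shows "nilpotent"
proof -
  have "bracket x v = 0" if "v \<in> lower_central 1" for x v
    using that[unfolded One_nat_def lower_central.simps]
    by (induction rule: span_induct_alt)
      (auto simp: assms bracket_add_right bracket_scale_right)
  then have "{bracket x y |x y. y \<in> lower_central 1} \<subseteq> {0}"
    by blast
  then have "lower_central 2 \<subseteq> {0}"
    using span_mono[of _ "{0}"] by (simp add: numeral_2_eq_2)
  then have "lower_central 2 = {0}"
    using zero_in_lower_central[of 2] by blast
  then show ?thesis
    unfolding nilpotent_def by blast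
qed

text \<open>The map \<open>g\<close> turns coordinates into vectors, a direction in which linearity
  and compatibility with brackets follow by expansion. The isomorphism required here goes the other
  way and is \<open>inv g\<close>.\<close>

lemma lie_isomorphic_if_basis:
  fixes bracket' :: "'f ^ 3 \<Rightarrow> 'f ^ 3 \<Rightarrow> 'f ^ 3"
  assumes ind: "independent {x, y, z}" and card: "card {x, y, z} = 3" and sp: "span {x, y, z} = UNIV"
    and g: "\<And>v. g v = scale (v $ 1) x + scale (v $ 2) y + scale (v $ 3) z"
    and hom: "\<And>u v. g (bracket' u v) = bracket (g u) (g v)"
  shows "lie_isomorphic scale bracket (*s) bracket'"
proof -
  interpret vs: vector_space_pair "(*s) :: 'f \<Rightarrow> 'f ^ 3 \<Rightarrow> 'f ^ 3" scale ..
  have lin: "Vector_Spaces.linear (*s) scale g"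
    by unfold_locales (simp_all add: g algebra_simps)
  have distinct: "x \<noteq> y" "x \<noteq> z" "y \<noteq> z"
    using card by (auto simp: card_insert_if split: if_splits)
  have "v = 0" if "g v = 0" for v
  proof -
    \<comment> \<open>The coordinates of v become a coefficient function on the basis; distinctness
      of x, y, z lets each coordinate be read off again.\<close>
    define c where "c u = (if u = x then v $ 1 else if u = y then v $ 2 else v $ 3)" for u
    have "(\<Sum>u\<in>{x, y, z}. scale (c u) u) = 0"
      using that distinct by (simp add: g c_def add.assoc)
    then have "c u = 0" if "u \<in> {x, y, z}" for u
      using independentD[OF ind, of "{x, y, z}" c u] that by blast
    from this[of x] this[of y] this[of z] distinct show ?thesis
      by (simp add: c_def vec_eq_iff forall_3)
  qed
  then have "inj g"
    using vs.linear_inj_iff_eq_0[OF lin] by blast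
  moreover have "surj g"
    unfolding surj_def
  proof
    fix u
    have "u \<in> span {x, y, z}" using sp by simp
    then obtain a b c where "u = scale a x + scale b y + scale c z"
      by (auto simp: span_insert span_singleton algebra_simps)
    then have "u = g (vector [a, b, c])"
      by (simp add: g)
    then show "\<exists>v. u = g v" ..
  qed
  ultimately have bij: "bij g" by (simp add: bij_def)
  \<comment> \<open>A linear left inverse of the bijection \<open>g\<close> must be
    \<open>inv g\<close>, which is therefore linear.\<close>
  obtain h where h: "Vector_Spaces.linear scale (*s) h" "h \<circ> g = id"
    using vs.linear_injective_left_inverse[OF lin \<open>inj g\<close>] by blast
  have hg: "h (g v) = v" for v
    using h(2) by (simp add: pointfree_idE)
  have "inv g u = h u" for u
    using \<open>surj g\<close> by (metis hg surj_f_inv_f)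
  then have "inv g = h" by blast
  with h(1) have "Vector_Spaces.linear scale (*s) (inv g)" by simp
  moreover have "inv g (bracket u v) = bracket' (inv g u) (inv g v)" for u v
  proof -
    have "bracket u v = g (bracket' (inv g u) (inv g v))"
      by (simp add: hom surj_f_inv_f[OF \<open>surj g\<close>])
    then show ?thesis
      by (simp add: inv_f_f[OF \<open>inj g\<close>])
  qed
  ultimately show ?thesis
    unfolding lie_isomorphic_def using bij_imp_bij_inv[OF bij] by blast
qed

end

section \<open>The two model algebras\<close>

lemma L31_eq [simp]: "L31 x y = 0"
  by (simp add: L31_def table_bracket_def)

lemma L32_nth:
  "L32 x y $ 1 = 0" "L32 x y $ 2 = 0" "L32 x y $ 3 = x $ 1 * y $ 2 - x $ 2 * y $ 1"
  by (simp_all add: L32_def table_bracket_def sum_3 axis_def)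

lemma lie_algebra_L31: "lie_algebra (*s) L31"
  by unfold_locales simp_all

lemma lie_algebra_L32: "lie_algebra (*s) L32"
  by unfold_locales (simp_all add: vec_eq_iff forall_3 L32_nth algebra_simps)

lemma L32_double_bracket: "L32 x (L32 y z) = 0"
  by (simp add: vec_eq_iff forall_3 L32_nth)

lemma not_lie_isomorphic_L31_L32:
  "\<not> lie_isomorphic ((*s) :: 'f::field \<Rightarrow> 'f ^ 3 \<Rightarrow> 'f ^ 3) L31 (*s) L32"
proof
  assume "lie_isomorphic ((*s) :: 'f \<Rightarrow> 'f ^ 3 \<Rightarrow> 'f ^ 3) L31 (*s) L32"
  then obtain f :: "'f ^ 3 \<Rightarrow> 'f ^ 3" where lin: "Vector_Spaces.linear (*s) (*s) f"
    and "bij f" and f: "\<And>x y. f (L31 x y) = L32 (f x) (f y)"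
    unfolding lie_isomorphic_def by blast
  obtain x y where "f x = axis 1 1" "f y = axis 2 1"
    using \<open>bij f\<close> by (metis bij_pointE)
  then have "L32 (axis 1 1) (axis 2 1) = f 0"
    using f[of x y] by simp
  also have "f 0 = 0"
    using lin by (rule vec.linear_0)
  finally have "L32 (axis 1 1 :: 'f ^ 3) (axis 2 1) $ 3 = 0" by simp
  then show False
    by (simp add: L32_nth axis_def)
qed

lemma (in lie_algebra) nilpotent_dim_3_classification:
  assumes nil: "nilpotent" and dim: "dim UNIV = 3"
  shows "lie_isomorphic scale bracket (*s) L31 \<or> lie_isomorphic scale bracket (*s) L32"
proof (cases "abelian")
  case True
  obtain B where B: "independent B" "span B = UNIV" "card B = 3"
    using finite_basis_if_dim_pos[OF dim] by auto
  then obtain x y z where "B = {x, y, z}"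
    by (auto simp: card_3_iff)
  with B True have "lie_isomorphic scale bracket (*s) L31"
    by (intro lie_isomorphic_if_basis[of x y z
        "\<lambda>v. scale (v $ 1) x + scale (v $ 2) y + scale (v $ 3) z"]) (auto simp: abelian_def)
  then show ?thesis ..
next
  case False
  then obtain x y where w: "bracket x y \<noteq> 0"
    by (auto simp: abelian_def)
  define z where "z = bracket x y"
  have central: "bracket u z = 0" "bracket z u = 0" for u
    using bracket_central_if_dim_le_3[OF nil, of u x y] bracket_minus_flip[of z u] dim
    by (simp_all add: z_def)
  note basis = independent_bracket_central[OF w w[folded z_def] central(1)]
  have "span {x, y, z} = UNIV"
    using independent_spans_if_dim_le(1)[OF dim _ basis(1)] basis(2) by simp
  with basis have "lie_isomorphic scale bracket (*s) L32"
    using bracket_minus_flip[of y x]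
    by (intro lie_isomorphic_if_basis[of x y z
        "\<lambda>v. scale (v $ 1) x + scale (v $ 2) y + scale (v $ 3) z"])
      (auto simp: L32_nth bracket_add_left bracket_add_right bracket_scale_left bracket_scale_right
         bracket_self central z_def[symmetric] algebra_simps)
  then show ?thesis ..
qed

theorem proposition5p1:
  fixes scale :: "'f::field \<Rightarrow> 'v::ab_group_add \<Rightarrow> 'v"
    and bracket :: "'v \<Rightarrow> 'v \<Rightarrow> 'v"
  assumes char: "CHAR('f) \<noteq> 2"
  shows
    "(lie_algebra scale bracket \<and> lie_algebra.nilpotent scale bracket \<longrightarrow>
        (vector_space.dim scale (UNIV :: 'v set) \<in> {1, 2} \<longrightarrow> lie_algebra.abelian bracket) \<and>
        (vector_space.dim scale (UNIV :: 'v set) = 3 \<longrightarrow>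
           lie_isomorphic scale bracket ((*s) :: 'f \<Rightarrow> 'f ^ 3 \<Rightarrow> 'f ^ 3) L31 \<or>
           lie_isomorphic scale bracket ((*s) :: 'f \<Rightarrow> 'f ^ 3 \<Rightarrow> 'f ^ 3) L32) \<and>
        (vector_space.dim scale (UNIV :: 'v set) \<in> {1, 2, 3} \<longrightarrow>
           lie_algebra.CB_algebra bracket)) \<and>
     vector_space.dim ((*s) :: 'f \<Rightarrow> 'f ^ 3 \<Rightarrow> 'f ^ 3) UNIV = 3 \<and>
     lie_algebra ((*s) :: 'f \<Rightarrow> 'f ^ 3 \<Rightarrow> 'f ^ 3) L31 \<and>
     lie_algebra.nilpotent ((*s) :: 'f \<Rightarrow> 'f ^ 3 \<Rightarrow> 'f ^ 3) L31 \<and>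
     lie_algebra.abelian (L31 :: 'f ^ 3 \<Rightarrow> 'f ^ 3 \<Rightarrow> 'f ^ 3) \<and>
     lie_algebra.CB_algebra (L31 :: 'f ^ 3 \<Rightarrow> 'f ^ 3 \<Rightarrow> 'f ^ 3) \<and>
     lie_algebra ((*s) :: 'f \<Rightarrow> 'f ^ 3 \<Rightarrow> 'f ^ 3) L32 \<and>
     lie_algebra.nilpotent ((*s) :: 'f \<Rightarrow> 'f ^ 3 \<Rightarrow> 'f ^ 3) L32 \<and>
     lie_algebra.CB_algebra (L32 :: 'f ^ 3 \<Rightarrow> 'f ^ 3 \<Rightarrow> 'f ^ 3) \<and>
     \<not> lie_isomorphic ((*s) :: 'f \<Rightarrow> 'f ^ 3 \<Rightarrow> 'f ^ 3) L31 ((*s) :: 'f \<Rightarrow> 'f ^ 3 \<Rightarrow> 'f ^ 3) L32"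
proof (intro conjI impI; (elim conjE)?)
  assume L: "lie_algebra scale bracket" and nil: "lie_algebra.nilpotent scale bracket"
  interpret lie_algebra scale bracket by fact
  show "lie_algebra.abelian bracket" if "dim UNIV \<in> {1, 2}"
    using abelian_if_dim_le_2 nil that by blast
  show "lie_isomorphic scale bracket ((*s) :: 'f \<Rightarrow> 'f ^ 3 \<Rightarrow> 'f ^ 3) L31 \<or>
      lie_isomorphic scale bracket ((*s) :: 'f \<Rightarrow> 'f ^ 3 \<Rightarrow> 'f ^ 3) L32" if "dim UNIV = 3"
    using nilpotent_dim_3_classification nil that by blast
  show "lie_algebra.CB_algebra bracket" if "dim UNIV \<in> {1, 2, 3}"
    using CB_if_double_bracket_zero bracket_central_if_dim_le_3 nil that by blast
next
  interpret L31: lie_algebra "(*s) :: 'f \<Rightarrow> 'f ^ 3 \<Rightarrow> 'f ^ 3" L31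
    by (rule lie_algebra_L31)
  interpret L32: lie_algebra "(*s) :: 'f \<Rightarrow> 'f ^ 3 \<Rightarrow> 'f ^ 3" L32
    by (rule lie_algebra_L32)
  show "L31.nilpotent" "L31.CB_algebra"
    by (simp_all add: L31.nilpotent_if_double_bracket_zero L31.CB_if_double_bracket_zero)
  show "L31.abelian"
    by (simp add: L31.abelian_def)
  show "L32.nilpotent" "L32.CB_algebra"
    by (simp_all add: L32.nilpotent_if_double_bracket_zero L32.CB_if_double_bracket_zero
        L32_double_bracket)
  show "vec.dim (UNIV :: ('f ^ 3) set) = 3"
    by (simp add: card_cart_basis)
qed (rule lie_algebra_L31 lie_algebra_L32 not_lie_isomorphic_L31_L32)+

end
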